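(* Let $0<\alpha<n$. There is a constant $c$ such that for any weight $u$ on $\mathbb{R}^n$ and every $f\in L^1((Mu)^{1-\frac{\alpha}{n}})$, $$\|I_\alpha f\|_{L^{(n/\alpha)',\infty}(u)}\le c\,\|f\|_{L^1((Mu)^{1-\frac{\alpha}{n}})}.$$
   Context: For $0<\alpha<n$, the fractional integral operator (Riesz potential) is $I_\alpha f(x)=\int_{\mathbb{R}^n}\frac{f(y)}{|x-y|^{n-\alpha}}\,dy$. The exponent $(n/\alpha)'=n/(n-\alpha)$ is the dual exponent of $n/\alpha$. A weight is a non-negative locally integrable function on $\mathbb{R}^n$. $M$ is the Hardy–Littlewood maximal function $Mu(x)=\sup_{Q\ni x}\frac1{|Q|}\int_Q|u(y)|\,dy$, the supremum being over cubes $Q$ with sides parallel to the axes. $\|f\|_{L^1(v)}=\int_{\mathbb{R}^n}|f|\,v\,dx$. With $u(E)=\int_E u\,dx$, $\|g\|_{L^{q,\infty}(u)}=\sup_{\lambda>0}\lambda\,u(\{x:|g(x)|>\lambda\})^{1/q}$. *)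

theory Defs
  imports "HOL-Analysis.Analysis"
begin

(* Powers of extended nonnegative reals, meant for exponents p > 0 only: then 0 is sent to 0
   and infinity to infinity. *)
definition epow :: "ennreal \<Rightarrow> real \<Rightarrow> ennreal" where
  "epow x p = (if x = \<infinity> then \<infinity> else ennreal (enn2real x powr p))"

definition dual_exponent :: "real \<Rightarrow> real" where
  "dual_exponent p = p / (p - 1)"

definition weight :: "(real ^ 'n \<Rightarrow> real) \<Rightarrow> bool" where
  "weight u \<longleftrightarrow> (\<forall>x. 0 \<le> u x) \<and> (\<forall>K. compact K \<longrightarrow> set_integrable lebesgue K u)"

definition weight_measure :: "(real ^ 'n \<Rightarrow> real) \<Rightarrow> (real ^ 'n) set \<Rightarrow> ennreal" where
  "weight_measure u E = (\<integral>\<^sup>+x\<in>E. ennreal (u x) \<partial>lebesgue)"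

definition is_cube :: "(real ^ 'n) set \<Rightarrow> bool" where
  "is_cube Q \<longleftrightarrow> (\<exists>a l. 0 < l \<and> Q = cbox a (a + vec l))"

definition HL_maximal :: "(real ^ 'n \<Rightarrow> real) \<Rightarrow> real ^ 'n \<Rightarrow> ennreal" where
  "HL_maximal u x =
     (SUP Q\<in>{Q. is_cube Q \<and> x \<in> Q}. (\<integral>\<^sup>+y\<in>Q. ennreal \<bar>u y\<bar> \<partial>lebesgue) / emeasure lebesgue Q)"

definition riesz_kernel :: "real \<Rightarrow> real ^ 'n \<Rightarrow> real" where
  "riesz_kernel \<alpha> z = 1 / norm z powr (real CARD('n) - \<alpha>)"

(* The Bochner integral is 0 by convention where it does not converge absolutely, so a claim
   about frac_integral should come with riesz_convergent at the relevant points. *)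
definition frac_integral :: "real \<Rightarrow> (real ^ 'n \<Rightarrow> complex) \<Rightarrow> real ^ 'n \<Rightarrow> complex" where
  "frac_integral \<alpha> f x = (LINT y|lebesgue. riesz_kernel \<alpha> (x - y) *\<^sub>R f y)"

definition riesz_convergent :: "real \<Rightarrow> (real ^ 'n \<Rightarrow> complex) \<Rightarrow> real ^ 'n \<Rightarrow> bool" where
  "riesz_convergent \<alpha> f x \<longleftrightarrow> integrable lebesgue (\<lambda>y. riesz_kernel \<alpha> (x - y) *\<^sub>R f y)"

definition L1_norm :: "(real ^ 'n \<Rightarrow> ennreal) \<Rightarrow> (real ^ 'n \<Rightarrow> complex) \<Rightarrow> ennreal" where
  "L1_norm v f = (\<integral>\<^sup>+x. ennreal (norm (f x)) * v x \<partial>lebesgue)"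

definition L1_space :: "(real ^ 'n \<Rightarrow> ennreal) \<Rightarrow> (real ^ 'n \<Rightarrow> complex) set" where
  "L1_space v = {f. f \<in> borel_measurable lebesgue \<and> L1_norm v f < \<infinity>}"

definition weak_norm :: "real \<Rightarrow> (real ^ 'n \<Rightarrow> real) \<Rightarrow> (real ^ 'n \<Rightarrow> complex) \<Rightarrow> ennreal" where
  "weak_norm q u g =
     (SUP t\<in>{0<..}. ennreal t * epow (weight_measure u {x. norm (g x) > t}) (1 / q))"

end

theory Submission
  imports Defs
begin

text \<open>
  The heart of the matter is that the Riesz kernel centred at \<open>y\<close> lies in weak \<open>L^q(u)\<close>,
  \<open>q = (n/\<alpha>)'\<close>, with norm at most a constant times \<open>Mu(y)^(1/q)\<close>: its superlevel sets are
  balls around \<open>y\<close>, and \<open>u(B(y,r)) \<le> (2r)^n Mu(y)\<close>.  As \<open>q > 1\<close>, weak \<open>L^q\<close> carries an equivalent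
  norm, so the superposition \<open>\<integral> |f(y)| |x - y|^(\<alpha>-n) dy\<close> of such kernels has weak norm at most
  a constant times \<open>\<integral> |f| (Mu)^(1/q)\<close>, which is the claim.

  The equivalent norm is used in dual form.  If \<open>A\<close> has finite mass \<open>u(A) = m\<close>, then
  \<open>\<integral>\<^sub>A |x - y|^(\<alpha>-n) u(x) dx \<le> C m^(\<alpha>/n) Mu(y)^(1-\<alpha>/n)\<close>
  (\<open>nn_integral_weight_riesz_kernel_le\<close>).  If moreover the potential of \<open>|f|\<close> is at least \<open>t\<close>
  on \<open>A\<close>, integrating it over \<open>A\<close> against \<open>u\<close> and exchanging the order of integration gives
  \<open>t m \<le> C m^(\<alpha>/n) X\<close> with \<open>X\<close> the weighted \<open>L^1\<close> norm of \<open>f\<close>; dividing by \<open>m^(\<alpha>/n)\<close> bounds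
  \<open>m\<close> (\<open>weak_type_finite\<close>).  The superlevel sets themselves may have infinite mass a priori, so
  they are exhausted by bounded pieces (\<open>weak_type\<close>).

  All of this concerns the potential of \<open>|f|\<close>, which takes values in \<open>[0, \<infinity>]\<close> and
  dominates \<open>|I\<^sub>\<alpha> f|\<close>.  Letting \<open>t \<rightarrow> \<infinity>\<close> shows that it is finite \<open>u\<close>-almost everywhere, so the
  integral defining \<open>I\<^sub>\<alpha> f\<close> converges there.
\<close>

section \<open>The kernel against a measure of controlled growth\<close>

text \<open>
  The kernel is split at radius \<open>r\<close>: outside the ball it is bounded by its value on the sphere, and
  inside it is compared with a constant on each dyadic annulus
  \<open>r / 2 ^ (k + 1) < |z| \<le> r / 2 ^ k\<close>.  The annuli are enlarged to balls because it is the
  measure of balls that the maximal function controls.  At \<open>z = 0\<close> the kernel is \<open>0\<close> by the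
  convention for division.
\<close>
lemma riesz_kernel_le_dyadic:
  fixes z :: "real ^ 'n"
  assumes "\<alpha> < real CARD('n)" and r: "0 < r"
  shows "ennreal (riesz_kernel \<alpha> z) \<le> ennreal (r powr - (real CARD('n) - \<alpha>)) +
    (\<Sum>k. ennreal ((r / 2 ^ Suc k) powr - (real CARD('n) - \<alpha>)) * indicator (cball 0 (r / 2 ^ k)) z)"
    (is "_ \<le> _ + (\<Sum>k. ?g k)")
proof -
  define d where "d = real CARD('n) - \<alpha>"
  have d: "d > 0" using assms by (simp add: d_def)
  have ker: "riesz_kernel \<alpha> z = norm z powr - d"
    unfolding riesz_kernel_def d_def by (rule powr_minus_divide[symmetric])
  consider "z = 0" | "r \<le> norm z" | "z \<noteq> 0" "norm z < r" by linarith
  then show ?thesis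
  proof cases
    case 1
    then show ?thesis by (simp add: riesz_kernel_def)
  next
    case 2
    then have "norm z powr - d \<le> r powr - d" using d r by (intro powr_mono2') auto
    then have "ennreal (riesz_kernel \<alpha> z) \<le> ennreal (r powr - (real CARD('n) - \<alpha>))"
      unfolding ker d_def by (rule ennreal_leI)
    then show ?thesis by (rule add_increasing2[rotated]) simp
  next
    case 3
    have term_le: "h k \<le> (\<Sum>k. h k)" for h :: "nat \<Rightarrow> ennreal" and k
      using sum_le_suminf[of h "{k}"] by simp
    obtain j where "(1 / 2) ^ j < norm z / r"
      using 3 r real_arch_pow_inv[of "norm z / r" "1/2"] by auto
    then have "r / 2 ^ j < norm z" using r by (simp add: field_simps power_divide)
    moreover have "\<not> r / 2 ^ 0 < norm z" using 3 by simp
    ultimately obtain k where k: "r / 2 ^ Suc k < norm z" "\<not> r / 2 ^ k < norm z"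
      using ex_least_nat_less[of "\<lambda>k. r / 2 ^ k < norm z" j] by blast
    have "norm z powr - d \<le> (r / 2 ^ Suc k) powr - d"
      using d r k(1) by (intro powr_mono2') simp_all
    then have "ennreal (norm z powr - d) \<le> ennreal ((r / 2 ^ Suc k) powr - d)"
      by (rule ennreal_leI)
    moreover have "z \<in> cball 0 (r / 2 ^ k)" using k(2) by simp
    ultimately have "ennreal (riesz_kernel \<alpha> z) \<le> ?g k"
      unfolding ker d_def by (simp only: indicator_simps mult_1_right)
    also have "?g k \<le> (\<Sum>k. ?g k)"
      by (rule term_le)
    finally show ?thesis by (rule add_increasing[rotated]) simp
  qed
qed

text \<open>
  The summand \<open>1\<close> comes from the part of the kernel away from its centre, the other one from the
  geometric series with ratio \<open>2 powr - \<alpha>\<close> over the dyadic balls.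
\<close>
definition riesz_const :: "real \<Rightarrow> nat \<Rightarrow> real" where
  "riesz_const \<alpha> n = 1 + 2 powr (2 * real n - \<alpha>) / (1 - 2 powr - \<alpha>)"

lemma riesz_const_pos: "0 < \<alpha> \<Longrightarrow> 0 < riesz_const \<alpha> n"
proof -
  assume "0 < \<alpha>"
  then have "2 powr - \<alpha> < 2 powr (0::real)" by (intro powr_less_mono) auto
  then show ?thesis by (simp add: riesz_const_def add_pos_nonneg)
qed

text \<open>
  At splitting radius \<open>r\<close> the far part contributes at most \<open>r^(\<alpha>-n) m\<close> and the near part at most a
  constant times \<open>r^\<alpha> M\<close>, the dyadic sum converging because \<open>\<alpha> > 0\<close>.  The two balance at
  \<open>r^n = m / M\<close>.
\<close>
lemma nn_integral_riesz_kernel_le: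
  fixes \<nu> :: "(real ^ 'n) measure" and y :: "real ^ 'n"
  assumes \<alpha>: "0 < \<alpha>" "\<alpha> < real CARD('n)" and [simp]: "sets \<nu> = sets lebesgue"
    and m: "emeasure \<nu> UNIV = ennreal m" "0 < m" and M: "0 < M"
    and balls: "\<And>r. 0 < r \<Longrightarrow> emeasure \<nu> (cball y r) \<le> ennreal ((2 * r) ^ CARD('n) * M)"
  shows "(\<integral>\<^sup>+x. ennreal (riesz_kernel \<alpha> (x - y)) \<partial>\<nu>)
    \<le> ennreal (riesz_const \<alpha> CARD('n) * (m powr (\<alpha> / real CARD('n)) * M powr (1 - \<alpha> / real CARD('n))))"
proof -
  define n where "n = real CARD('n)"
  define d where "d = n - \<alpha>"
  define r where "r = (m / M) powr (1 / n)"
  \<comment> \<open>The common size of the two contributions at the balancing radius.\<close>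
  define P where "P = m powr (\<alpha> / n) * M powr (1 - \<alpha> / n)"
  have n: "n > 0" by (simp add: n_def)
  have r: "r > 0" using m M by (simp add: r_def)
  have sp: "space \<nu> = UNIV" using sets_eq_imp_space_eq[of \<nu> lebesgue] by simp
  have cb [measurable]: "cball y s \<in> sets \<nu>" for s by simp
  have P1: "r powr - d * m = P"
  proof -
    have "r powr - d * m = m powr (- d / n) * M powr (d / n) * m powr 1"
      using m M by (simp add: r_def powr_powr powr_divide powr_minus field_simps)
    also have "\<dots> = m powr (- d / n + 1) * M powr (d / n)" by (simp only: powr_add mult_ac)
    also have "d / n = 1 - \<alpha> / n" using n by (simp add: d_def field_simps)
    also have "- d / n + 1 = \<alpha> / n" using n by (simp add: d_def field_simps)
    finally show ?thesis by (simp add: P_def)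
  qed
  have P2: "r powr \<alpha> * M = P"
  proof -
    have "r powr n = m / M" using m M n by (simp add: r_def powr_powr)
    then have "r powr n * M = m" using M by simp
    moreover have "r powr \<alpha> = r powr - d * r powr n"
      unfolding powr_add[symmetric] by (simp add: d_def)
    ultimately show ?thesis using P1 by (simp only: mult.assoc)
  qed
  define c where "c = 2 powr (2 * n - \<alpha>)"
  define \<rho> where "\<rho> = 2 powr - \<alpha>"
  have \<rho>: "0 < \<rho>" "\<rho> < 1"
    using powr_less_mono[of "-\<alpha>" 0 2] \<alpha> by (auto simp: \<rho>_def)
  have annulus: "(r / 2 ^ Suc k) powr - d * ((2 * (r / 2 ^ k)) ^ CARD('n) * M) = c * P * \<rho> ^ k" for k
  proof -
    have pow2: "(2::real) ^ j = 2 powr real j" for j by (simp add: powr_realpow)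
    have "(r / 2 ^ Suc k) powr - d = r powr - d / 2 powr (- (d * (1 + real k)))"
      using r unfolding pow2 by (simp only: powr_divide powr_powr of_nat_Suc) (simp add: algebra_simps)
    also have "\<dots> = r powr - d * 2 powr (d * (1 + real k))"
      by (simp only: powr_minus divide_inverse inverse_inverse_eq)
    finally have "(r / 2 ^ Suc k) powr - d = r powr - d * 2 powr (d * (1 + real k))" .
    moreover have "(2 * (r / 2 ^ k)) ^ CARD('n) = r powr n * 2 powr (n - n * k)"
    proof -
      have "2 * (r / 2 ^ k) = r * 2 powr (1 - real k)" unfolding pow2 by (simp add: powr_diff)
      then have "(2 * (r / 2 ^ k)) ^ CARD('n) = (r * 2 powr (1 - real k)) powr n"
        using r by (simp add: n_def powr_realpow)
      also have "\<dots> = r powr n * 2 powr ((1 - real k) * n)"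
        using r by (simp only: powr_mult powr_powr)
      finally show ?thesis by (simp add: algebra_simps)
    qed
    moreover have "\<rho> ^ k = 2 powr (- \<alpha> * k)"
    proof -
      have "\<rho> ^ k = \<rho> powr real k" using \<rho> by (simp add: powr_realpow)
      then show ?thesis by (simp only: \<rho>_def powr_powr)
    qed
    moreover have "P = r powr (- d) * r powr n * M"
      using P2 by (simp only: d_def powr_add[symmetric]) simp
    moreover have "2 powr (d * (1 + real k)) * 2 powr (n - n * k) = c * 2 powr (- \<alpha> * k)"
      unfolding c_def d_def powr_add[symmetric] by (simp add: algebra_simps)
    ultimately show ?thesis by (simp add: mult_ac)
  qed
  have "(\<integral>\<^sup>+x. ennreal (riesz_kernel \<alpha> (x - y)) \<partial>\<nu>) \<le>
    (\<integral>\<^sup>+x. ennreal (r powr - d) +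
      (\<Sum>k. ennreal ((r / 2 ^ Suc k) powr - d) * indicator (cball y (r / 2 ^ k)) x) \<partial>\<nu>)"
  proof (rule nn_integral_mono)
    fix x
    have "indicator (cball 0 s) (x - y) = (indicator (cball y s) x :: ennreal)" for s
      by (simp add: indicator_def dist_norm norm_minus_commute)
    then show "ennreal (riesz_kernel \<alpha> (x - y)) \<le> ennreal (r powr - d) +
      (\<Sum>k. ennreal ((r / 2 ^ Suc k) powr - d) * indicator (cball y (r / 2 ^ k)) x)"
      using riesz_kernel_le_dyadic[OF \<alpha>(2) r, of "x - y"] by (simp add: d_def n_def)
  qed
  also have "\<dots> = ennreal (r powr - d) * emeasure \<nu> UNIV +
      (\<Sum>k. ennreal ((r / 2 ^ Suc k) powr - d) * emeasure \<nu> (cball y (r / 2 ^ k)))"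
    by (simp add: nn_integral_add nn_integral_suminf nn_integral_cmult sp)
  also have "\<dots> \<le> ennreal P + (\<Sum>k. ennreal (c * P * \<rho> ^ k))"
  proof (intro add_mono suminf_le)
    show "ennreal (r powr - d) * emeasure \<nu> UNIV \<le> ennreal P"
      using m P1 by (simp flip: ennreal_mult)
    fix k
    have "ennreal ((r / 2 ^ Suc k) powr - d) * emeasure \<nu> (cball y (r / 2 ^ k)) \<le>
        ennreal ((r / 2 ^ Suc k) powr - d) * ennreal ((2 * (r / 2 ^ k)) ^ CARD('n) * M)"
      using r by (intro mult_left_mono balls) auto
    also have "\<dots> = ennreal (c * P * \<rho> ^ k)"
      using annulus[of k] M r by (simp flip: ennreal_mult)
    finally show "ennreal ((r / 2 ^ Suc k) powr - d) * emeasure \<nu> (cball y (r / 2 ^ k)) \<le> ennreal (c * P * \<rho> ^ k)" .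
  qed auto
  also have "(\<Sum>k. ennreal (c * P * \<rho> ^ k)) = ennreal (c * P * (1 / (1 - \<rho>)))"
    using \<rho> m M by (intro suminf_ennreal_eq sums_mult geometric_sums) (auto simp: c_def P_def)
  also have "ennreal P + \<dots> = ennreal (riesz_const \<alpha> CARD('n) * P)"
    using \<rho> by (subst ennreal_plus[symmetric])
      (auto simp: c_def P_def riesz_const_def n_def \<rho>_def algebra_simps)
  finally show ?thesis by (simp add: P_def n_def)
qed

section \<open>Weights and the maximal function\<close>

lemma ball_le_HL_maximal:
  fixes u :: "real ^ 'n \<Rightarrow> real"
  assumes "0 < r"
  shows "(\<integral>\<^sup>+x\<in>cball y r. ennreal (u x) \<partial>lebesgue) \<le> ennreal ((2 * r) ^ CARD('n)) * HL_maximal u y"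
proof -
  define Q where "Q = cbox (y - vec r) (y - vec r + vec (2 * r))"
  have Q: "is_cube Q" using assms unfolding is_cube_def Q_def by (intro exI[of _ "y - vec r"] exI[of _ "2 * r"]) auto
  have sub: "cball y r \<subseteq> Q"
  proof
    fix x assume "x \<in> cball y r"
    then have "y $ i - r \<le> x $ i \<and> x $ i \<le> y $ i + r" for i
      using component_le_norm_cart[of "y - x" i]
      unfolding mem_cball dist_norm vector_minus_component by linarith
    then show "x \<in> Q" by (simp add: Q_def mem_box_cart add.commute)
  qed
  have "Q \<noteq> {}" using sub assms by force
  then have vol: "emeasure lebesgue Q = ennreal ((2 * r) ^ CARD('n))"
    by (simp add: Q_def emeasure_eq_measure2 content_cbox_cart emeasure_lborel_cbox_eq)
  have y: "y \<in> Q" using sub assms by auto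
  have "(\<integral>\<^sup>+x\<in>cball y r. ennreal (u x) \<partial>lebesgue) \<le> (\<integral>\<^sup>+x\<in>Q. ennreal \<bar>u x\<bar> \<partial>lebesgue)" (is "_ \<le> ?I")
    using sub by (intro nn_integral_mono mult_mono ennreal_leI) (auto simp: indicator_def)
  also have "?I = emeasure lebesgue Q * (?I / emeasure lebesgue Q)"
    using assms unfolding vol ennreal_times_divide
    by (subst mult.commute, subst ennreal_mult_divide_eq) simp_all
  also have "\<dots> \<le> ennreal ((2 * r) ^ CARD('n)) * HL_maximal u y"
    unfolding HL_maximal_def vol[symmetric] using Q y by (intro mult_left_mono SUP_upper) auto
  finally show ?thesis .
qed

text \<open>Integrability on compact sets gives measurability of the truncations, hence of their limit.\<close>
lemma weight_borel_measurable:
  assumes "weight u"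
  shows "u \<in> borel_measurable lebesgue"
proof (rule borel_measurable_LIMSEQ_real)
  show "(\<lambda>x. indicator (cball 0 (real i)) x *\<^sub>R u x) \<in> borel_measurable lebesgue" for i
    using assms by (auto simp: weight_def set_integrable_def dest!: spec[of _ "cball 0 (real i)"])
  fix x
  have "\<forall>\<^sub>F i in sequentially. indicator (cball 0 (real i)) x *\<^sub>R u x = u x"
    using eventually_ge_at_top[of "nat \<lceil>norm x\<rceil>"]
    by eventually_elim (auto simp: indicator_def)
  then show "(\<lambda>i. indicator (cball 0 (real i)) x *\<^sub>R u x) \<longlonglongrightarrow> u x"
    by (rule tendsto_eventually)
qed

lemma weight_measure_cball_finite:
  assumes "weight u"
  shows "weight_measure u (cball y r) < \<infinity>"
proof -
  have "set_integrable lebesgue (cball y r) u" using assms by (auto simp: weight_def)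
  then have "(\<integral>\<^sup>+x. ennreal (norm (indicator (cball y r) x *\<^sub>R u x)) \<partial>lebesgue) < \<infinity>"
    by (simp add: set_integrable_def integrable_iff_bounded)
  also have "(\<integral>\<^sup>+x. ennreal (norm (indicator (cball y r) x *\<^sub>R u x)) \<partial>lebesgue) = weight_measure u (cball y r)"
    unfolding weight_measure_def using assms
    by (intro nn_integral_cong) (auto simp: weight_def indicator_def)
  finally show ?thesis .
qed

lemma weight_measure_mono: "A \<subseteq> B \<Longrightarrow> weight_measure u A \<le> weight_measure u B"
  unfolding weight_measure_def by (intro nn_integral_mono mult_left_mono) (auto simp: indicator_def)

lemma riesz_kernel_borel_measurable [measurable]: "riesz_kernel \<alpha> \<in> borel_measurable borel"
  unfolding riesz_kernel_def by measurable

lemma riesz_kernel_diff_borel_measurable [measurable]: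
  fixes x :: "real ^ 'n"
  shows "(\<lambda>y. riesz_kernel \<alpha> (x - y)) \<in> borel_measurable lebesgue"
    and "(\<lambda>y. riesz_kernel \<alpha> (y - x)) \<in> borel_measurable lebesgue"
  by (rule measurable_completion, measurable)+

text \<open>
  The general estimate is applied to the restriction of \<open>u dx\<close> to \<open>A\<close>.  The degenerate values of the
  maximal function do no harm: if it is infinite, so is the right-hand side, as \<open>m > 0\<close>; if it
  vanishes at one point, then \<open>u\<close> vanishes almost everywhere, contradicting \<open>m > 0\<close>.
\<close>
lemma nn_integral_weight_riesz_kernel_le:
  fixes u :: "real ^ 'n \<Rightarrow> real"
  assumes \<alpha>: "0 < \<alpha>" "\<alpha> < real CARD('n)" and u: "weight u" and [measurable]: "A \<in> sets lebesgue"
    and m: "weight_measure u A = ennreal m" "0 < m"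
  shows "(\<integral>\<^sup>+x\<in>A. ennreal (u x) * ennreal (riesz_kernel \<alpha> (x - y)) \<partial>lebesgue)
    \<le> ennreal (riesz_const \<alpha> CARD('n) * m powr (\<alpha> / real CARD('n))) *
      epow (HL_maximal u y) (1 - \<alpha> / real CARD('n))"
proof (cases "HL_maximal u y")
  case top
  have "riesz_const \<alpha> CARD('n) * m powr (\<alpha> / real CARD('n)) > 0"
    using riesz_const_pos[OF \<alpha>(1)] m by simp
  then have "ennreal (riesz_const \<alpha> CARD('n) * m powr (\<alpha> / real CARD('n))) \<noteq> 0"
    by (simp only: ennreal_eq_0_iff not_le)
  then have "ennreal (riesz_const \<alpha> CARD('n) * m powr (\<alpha> / real CARD('n))) * \<infinity> = \<infinity>"
    by (simp only: ennreal_mult_eq_top_iff infinity_ennreal_def) simp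
  then show ?thesis by (simp add: top epow_def)
next
  case (real M)
  note [measurable] = weight_borel_measurable[OF u]
  define \<nu> where "\<nu> = density lebesgue (\<lambda>x. ennreal (u x) * indicator A x)"
  have sets: "sets \<nu> = sets lebesgue" by (simp add: \<nu>_def)
  have em: "emeasure \<nu> E = weight_measure u (A \<inter> E)" if "E \<in> sets lebesgue" for E
    using that unfolding \<nu>_def weight_measure_def
    by (subst emeasure_density) (auto intro!: nn_integral_cong simp: indicator_def)
  have tot: "emeasure \<nu> UNIV = ennreal m" using m by (simp add: em)
  have balls: "emeasure \<nu> (cball y r) \<le> ennreal ((2 * r) ^ CARD('n) * M)" if "0 < r" for r
  proof -
    have "emeasure \<nu> (cball y r) \<le> weight_measure u (cball y r)"
      by (simp add: em weight_measure_mono)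
    also have "\<dots> \<le> ennreal ((2 * r) ^ CARD('n)) * HL_maximal u y"
      using ball_le_HL_maximal[OF that] by (simp add: weight_measure_def)
    finally show ?thesis using real that by (simp add: ennreal_mult)
  qed
  have "M > 0"
  proof (rule ccontr)
    assume "\<not> M > 0"
    then have "M = 0" using real by simp
    then have "emeasure \<nu> (cball y (real (Suc k))) = 0" for k
      using balls[of "real (Suc k)"] by simp
    then have "emeasure \<nu> (\<Union>k. cball y (real (Suc k))) = 0"
      by (intro emeasure_UN_eq_0) (auto simp: sets)
    moreover have "x \<in> (\<Union>k. cball y (real (Suc k)))" for x
    proof -
      obtain k where "dist y x \<le> real k" using real_arch_simple by blast
      then have "x \<in> cball y (real (Suc k))" by simp
      then show ?thesis by blast
    qed
    then have "(\<Union>k. cball y (real (Suc k))) = UNIV" by blast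
    ultimately show False using tot m by simp
  qed
  have "(\<integral>\<^sup>+x\<in>A. ennreal (u x) * ennreal (riesz_kernel \<alpha> (x - y)) \<partial>lebesgue) =
      (\<integral>\<^sup>+x. ennreal (riesz_kernel \<alpha> (x - y)) \<partial>\<nu>)"
    unfolding \<nu>_def by (subst nn_integral_density) (auto simp: mult_ac)
  also have "\<dots> \<le> ennreal (riesz_const \<alpha> CARD('n) *
      (m powr (\<alpha> / real CARD('n)) * M powr (1 - \<alpha> / real CARD('n))))"
    by (rule nn_integral_riesz_kernel_le[OF \<alpha> sets tot m(2) \<open>M > 0\<close> balls])
  also have "\<dots> = ennreal (riesz_const \<alpha> CARD('n) * m powr (\<alpha> / real CARD('n))) *
      epow (HL_maximal u y) (1 - \<alpha> / real CARD('n))"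
    using riesz_const_pos[OF \<alpha>(1), of "CARD('n)"] real m
    by (simp add: epow_def mult.assoc flip: ennreal_mult)
  finally show ?thesis .
qed

section \<open>The weak-type bound for the potential of the absolute value\<close>

lemma sigma_finite_lebesgue: "sigma_finite_measure (lebesgue :: 'a :: euclidean_space measure)"
proof
  show "\<exists>A. countable A \<and> A \<subseteq> sets (lebesgue :: 'a measure) \<and> \<Union> A = space lebesgue \<and>
      (\<forall>a\<in>A. emeasure lebesgue a \<noteq> \<infinity>)"
  proof (intro exI[of _ "range (\<lambda>i::nat. cball (0::'a) (real i))"] conjI ballI)
    show "\<Union> (range (\<lambda>i::nat. cball (0::'a) (real i))) = space lebesgue"
      by (auto simp: real_arch_simple)
    fix a assume "a \<in> range (\<lambda>i::nat. cball (0::'a) (real i))"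
    then obtain i where "a = cball 0 (real i)" by auto
    then show "emeasure lebesgue a \<noteq> \<infinity>"
      using fmeasurableD2[OF lmeasurable_cball[of "0::'a" "real i"]] by simp
  qed auto
qed

text \<open>
  Pulling a constant out of an integral takes a measurable integrand, so the constant is moved to
  the side of \<open>f\<close>.  An arbitrary \<open>g\<close> on the right is the form in which pointwise bounds by the
  maximal function get integrated.
\<close>
lemma nn_integral_le_cmult:
  assumes [measurable]: "f \<in> borel_measurable M" and "0 < c" and le: "\<And>x. f x \<le> ennreal c * g x"
  shows "(\<integral>\<^sup>+x. f x \<partial>M) \<le> ennreal c * (\<integral>\<^sup>+x. g x \<partial>M)"
proof -
  have inv: "ennreal c * (ennreal (1 / c) * z) = z" "ennreal (1 / c) * (ennreal c * z) = z" for z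
    using \<open>0 < c\<close> by (simp_all flip: mult.assoc ennreal_mult)
  have "(\<integral>\<^sup>+x. f x \<partial>M) = ennreal c * (\<integral>\<^sup>+x. ennreal (1 / c) * f x \<partial>M)"
    by (simp add: nn_integral_cmult inv)
  also have "\<dots> \<le> ennreal c * (\<integral>\<^sup>+x. g x \<partial>M)"
  proof (intro mult_left_mono nn_integral_mono)
    show "ennreal (1 / c) * f x \<le> g x" for x
      using mult_left_mono[OF le, of "ennreal (1 / c)" x] by (simp add: inv)
  qed simp
  finally show ?thesis .
qed

definition abs_riesz :: "real \<Rightarrow> (real ^ 'n \<Rightarrow> complex) \<Rightarrow> real ^ 'n \<Rightarrow> ennreal" where
  "abs_riesz \<alpha> f x = (\<integral>\<^sup>+y. ennreal (riesz_kernel \<alpha> (x - y)) * ennreal (norm (f y)) \<partial>lebesgue)"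

text \<open>
  Kernel and subtraction are Borel measurable, so it is enough that the projections are measurable
  into the Borel space, which is coarser than the Lebesgue one.
\<close>
lemma measurable_kernel_pair:
  "(\<lambda>p. ennreal (riesz_kernel \<alpha> (fst p - snd p)))
    \<in> borel_measurable ((lebesgue :: (real ^ 'n) measure) \<Otimes>\<^sub>M lebesgue)"
proof -
  have [measurable]: "fst \<in> lebesgue \<Otimes>\<^sub>M lebesgue \<rightarrow>\<^sub>M (borel :: (real ^ 'n) measure)"
    "snd \<in> lebesgue \<Otimes>\<^sub>M lebesgue \<rightarrow>\<^sub>M (borel :: (real ^ 'n) measure)"
    using measurable_comp[OF measurable_fst, of "\<lambda>x. x" lebesgue borel lebesgue]
      measurable_comp[OF measurable_snd, of "\<lambda>x. x" lebesgue borel lebesgue]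
    by (auto simp: comp_def measurable_completion)
  show ?thesis by measurable
qed

lemma abs_riesz_borel_measurable:
  assumes [measurable]: "f \<in> borel_measurable lebesgue"
  shows "abs_riesz \<alpha> f \<in> borel_measurable lebesgue"
proof -
  interpret sigma_finite_measure "lebesgue :: (real ^ 'a) measure" by (rule sigma_finite_lebesgue)
  note [measurable] = measurable_kernel_pair
  show ?thesis unfolding abs_riesz_def
    by (rule borel_measurable_nn_integral)
       (simp add: split_beta')
qed

text \<open>
  The inequality \<open>t m \<le> C m powr (\<alpha> / n) X\<close> for the mass \<open>m\<close> of \<open>A\<close> says nothing when \<open>m = \<infinity>\<close>;
  for finite \<open>m\<close> the factor \<open>m powr (\<alpha> / n)\<close> cancels, and the remaining power of \<open>m\<close> has the
  positive exponent \<open>1 - \<alpha> / n\<close>.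
\<close>
lemma weak_type_finite:
  fixes u :: "real ^ 'n \<Rightarrow> real"
  assumes \<alpha>: "0 < \<alpha>" "\<alpha> < real CARD('n)" and u: "weight u"
    and f [measurable]: "f \<in> borel_measurable lebesgue"
    and X: "L1_norm (\<lambda>x. epow (HL_maximal u x) (1 - \<alpha> / real CARD('n))) f = ennreal X" "0 \<le> X"
    and t: "0 < t" and [measurable]: "A \<in> sets lebesgue"
    and A: "\<And>x. x \<in> A \<Longrightarrow> ennreal t \<le> abs_riesz \<alpha> f x" and fin: "weight_measure u A < \<infinity>"
  shows "weight_measure u A
    \<le> ennreal ((riesz_const \<alpha> CARD('n) * X / t) powr (1 / (1 - \<alpha> / real CARD('n))))"
proof -
  define n where "n = real CARD('n)"
  define C where "C = riesz_const \<alpha> CARD('n)"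
  have C: "C > 0" by (simp add: C_def riesz_const_pos \<alpha>)
  obtain m where m: "weight_measure u A = ennreal m" "0 \<le> m"
    using fin by (cases "weight_measure u A") auto
  show ?thesis
  proof (cases "m = 0")
    case True
    then show ?thesis using m by simp
  next
    case False
    then have m0: "m > 0" using m by simp
    interpret pair_sigma_finite "lebesgue :: (real ^ 'n) measure" "lebesgue :: (real ^ 'n) measure"
      by (intro pair_sigma_finite.intro sigma_finite_lebesgue)
    note [measurable] = weight_borel_measurable[OF u] measurable_kernel_pair abs_riesz_borel_measurable[OF f]
    have "ennreal (t * m) = ennreal t * weight_measure u A"
      using t m by (simp add: ennreal_mult)
    also have "\<dots> = (\<integral>\<^sup>+x. ennreal t * (ennreal (u x) * indicator A x) \<partial>lebesgue)"
      unfolding weight_measure_def by (subst nn_integral_cmult) auto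
    also have "\<dots> \<le> (\<integral>\<^sup>+x. abs_riesz \<alpha> f x * (ennreal (u x) * indicator A x) \<partial>lebesgue)"
      using A by (intro nn_integral_mono) (auto simp: indicator_def intro!: mult_right_mono)
    also have "\<dots> = (\<integral>\<^sup>+x. \<integral>\<^sup>+y. ennreal (riesz_kernel \<alpha> (x - y)) * ennreal (norm (f y)) *
        (ennreal (u x) * indicator A x) \<partial>lebesgue \<partial>lebesgue)"
      unfolding abs_riesz_def by (subst nn_integral_multc) auto
    also have "\<dots> = (\<integral>\<^sup>+y. \<integral>\<^sup>+x. ennreal (riesz_kernel \<alpha> (x - y)) * ennreal (norm (f y)) *
        (ennreal (u x) * indicator A x) \<partial>lebesgue \<partial>lebesgue)"
      by (rule Fubini'[symmetric]) (simp add: split_beta')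
    also have "\<dots> = (\<integral>\<^sup>+y. ennreal (norm (f y)) *
        (\<integral>\<^sup>+x\<in>A. ennreal (u x) * ennreal (riesz_kernel \<alpha> (x - y)) \<partial>lebesgue) \<partial>lebesgue)"
      by (subst nn_integral_cmult[symmetric]) (auto simp: mult_ac)
    also have "\<dots> \<le> ennreal (C * m powr (\<alpha> / n)) *
        (\<integral>\<^sup>+y. ennreal (norm (f y)) * epow (HL_maximal u y) (1 - \<alpha> / n) \<partial>lebesgue)"
    proof (rule nn_integral_le_cmult)
      show "(\<lambda>y. ennreal (norm (f y)) *
        (\<integral>\<^sup>+x\<in>A. ennreal (u x) * ennreal (riesz_kernel \<alpha> (x - y)) \<partial>lebesgue)) \<in> borel_measurable lebesgue"
      proof -
        have "(\<lambda>y. \<integral>\<^sup>+x\<in>A. ennreal (u x) * ennreal (riesz_kernel \<alpha> (y - x)) \<partial>lebesgue) \<in> borel_measurable lebesgue"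
          by (rule sigma_finite_measure.borel_measurable_nn_integral[OF sigma_finite_lebesgue]) (simp add: split_beta')
        moreover have "riesz_kernel \<alpha> (x - y) = riesz_kernel \<alpha> (y - x)" for x y :: "real ^ 'n"
          by (simp add: riesz_kernel_def norm_minus_commute)
        ultimately show ?thesis by simp
      qed
      show "0 < C * m powr (\<alpha> / n)" using C m0 by simp
      fix y
      show "ennreal (norm (f y)) * (\<integral>\<^sup>+x\<in>A. ennreal (u x) * ennreal (riesz_kernel \<alpha> (x - y)) \<partial>lebesgue)
        \<le> ennreal (C * m powr (\<alpha> / n)) * (ennreal (norm (f y)) * epow (HL_maximal u y) (1 - \<alpha> / n))"
        using mult_left_mono[OF nn_integral_weight_riesz_kernel_le[OF \<alpha> u _ m(1) m0, of y],
            of "ennreal (norm (f y))"]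
        by (simp add: C_def n_def mult_ac)
    qed
    also have "\<dots> = ennreal (C * m powr (\<alpha> / n) * X)"
      using X C by (simp add: L1_norm_def n_def ennreal_mult)
    finally have "t * m \<le> C * m powr (\<alpha> / n) * X"
      using C X by (simp add: ennreal_le_iff)
    moreover have "m = m powr (\<alpha> / n) * m powr (1 - \<alpha> / n)"
      using m0 by (simp flip: powr_add)
    ultimately have "m powr (\<alpha> / n) * (t * m powr (1 - \<alpha> / n)) \<le> m powr (\<alpha> / n) * (C * X)"
      by (simp add: mult_ac)
    then have "m powr (1 - \<alpha> / n) \<le> C * X / t"
      using m0 t by (simp add: field_simps)
    moreover have e: "0 < 1 - \<alpha> / n" using \<alpha> by (simp add: n_def)
    ultimately have "(m powr (1 - \<alpha> / n)) powr (1 / (1 - \<alpha> / n)) \<le> (C * X / t) powr (1 / (1 - \<alpha> / n))"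
      by (intro powr_mono2) auto
    then show ?thesis using e m m0 by (simp add: powr_powr C_def n_def ennreal_leI)
  qed
qed

text \<open>The bound for sets of finite mass does not depend on the set, so it survives the exhaustion.\<close>
lemma weak_type:
  fixes u :: "real ^ 'n \<Rightarrow> real"
  assumes \<alpha>: "0 < \<alpha>" "\<alpha> < real CARD('n)" and u: "weight u"
    and f [measurable]: "f \<in> borel_measurable lebesgue"
    and X: "L1_norm (\<lambda>x. epow (HL_maximal u x) (1 - \<alpha> / real CARD('n))) f = ennreal X" "0 \<le> X"
    and t: "0 < t"
  shows "weight_measure u {x. ennreal t \<le> abs_riesz \<alpha> f x}
    \<le> ennreal ((riesz_const \<alpha> CARD('n) * X / t) powr (1 / (1 - \<alpha> / real CARD('n))))" (is "_ \<le> ?B")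
proof -
  note [measurable] = weight_borel_measurable[OF u] abs_riesz_borel_measurable[OF f]
  define E where "E = {x. ennreal t \<le> abs_riesz \<alpha> f x}"
  have "{x \<in> space lebesgue. ennreal t \<le> abs_riesz \<alpha> f x} \<in> sets lebesgue" by measurable
  then have E [measurable]: "E \<in> sets lebesgue" by (simp add: E_def)
  let ?D = "density lebesgue (\<lambda>x. ennreal (u x))"
  have em: "weight_measure u S = emeasure ?D S" if "S \<in> sets lebesgue" for S
    using that by (simp add: weight_measure_def emeasure_density)
  have "(SUP k. emeasure ?D (E \<inter> cball 0 (real k))) = emeasure ?D (\<Union>k. E \<inter> cball 0 (real k))"
    by (rule SUP_emeasure_incseq) (auto simp: incseq_def)
  also have "(\<Union>k. E \<inter> cball 0 (real k)) = E" by (auto simp: real_arch_simple)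
  finally have *: "(SUP k. emeasure ?D (E \<inter> cball 0 (real k))) = emeasure ?D E" .
  have EB: "E \<inter> cball 0 (real k) \<in> sets lebesgue" for k using E by auto
  with * have "weight_measure u E = (SUP k. weight_measure u (E \<inter> cball 0 (real k)))"
    by (simp add: em E)
  also have "\<dots> \<le> ?B"
  proof (rule SUP_least)
    fix k
    have "weight_measure u (E \<inter> cball 0 (real k)) < \<infinity>"
      using weight_measure_cball_finite[OF u] weight_measure_mono by (metis inf_le2 order_le_less_trans)
    then show "weight_measure u (E \<inter> cball 0 (real k)) \<le> ?B"
      using EB by (intro weak_type_finite[OF \<alpha> u f X t]) (auto simp: E_def)
  qed
  finally show ?thesis by (simp add: E_def)
qed

section \<open>The weighted weak-type inequality\<close>

lemma epow_mono: "x \<le> y \<Longrightarrow> 0 \<le> p \<Longrightarrow> epow x p \<le> epow y p"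
  by (auto simp: epow_def top_unique intro!: ennreal_leI powr_mono2 enn2real_mono simp: less_top)

theorem mainTheorem5:
  fixes \<alpha> :: real
  assumes "0 < \<alpha>" and "\<alpha> < real CARD('n)"
  shows "\<exists>c::real. c > 0 \<and>
    (\<forall>(u :: real ^ 'n \<Rightarrow> real) (f :: real ^ 'n \<Rightarrow> complex).
       weight u \<longrightarrow>
       f \<in> L1_space (\<lambda>x. epow (HL_maximal u x) (1 - \<alpha> / real CARD('n))) \<longrightarrow>
       (AE x in lebesgue. u x \<noteq> 0 \<longrightarrow> riesz_convergent \<alpha> f x) \<and>
       weak_norm (dual_exponent (real CARD('n) / \<alpha>)) u (frac_integral \<alpha> f)
         \<le> ennreal c * L1_norm (\<lambda>x. epow (HL_maximal u x) (1 - \<alpha> / real CARD('n))) f)"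
proof (intro exI[of _ "riesz_const \<alpha> CARD('n)"] conjI allI impI)
  show C: "riesz_const \<alpha> CARD('n) > 0" by (rule riesz_const_pos[OF assms(1)])
  fix u :: "real ^ 'n \<Rightarrow> real" and f :: "real ^ 'n \<Rightarrow> complex"
  assume u: "weight u" and f: "f \<in> L1_space (\<lambda>x. epow (HL_maximal u x) (1 - \<alpha> / real CARD('n)))"
  define p where "p = 1 - \<alpha> / real CARD('n)"
  define C where "C = riesz_const \<alpha> CARD('n)"
  let ?v = "\<lambda>x. epow (HL_maximal u x) (1 - \<alpha> / real CARD('n))"
  have C0: "C > 0" using C by (simp add: C_def)
  have p: "p > 0" using assms by (simp add: p_def)
  have fm [measurable]: "f \<in> borel_measurable lebesgue" and "L1_norm ?v f < \<infinity>"
    using f by (auto simp: L1_space_def)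
  then obtain X where X: "L1_norm ?v f = ennreal X" "0 \<le> X" by (cases "L1_norm ?v f") auto
  note [measurable] = weight_borel_measurable[OF u] abs_riesz_borel_measurable[OF fm]
  have weak: "weight_measure u {x. ennreal t \<le> abs_riesz \<alpha> f x} \<le> ennreal ((C * X / t) powr (1 / p))"
    if "0 < t" for t
    using weak_type[OF assms u fm X that] by (simp add: C_def p_def)
  have k_nonneg: "0 \<le> riesz_kernel \<alpha> z" for z :: "real ^ 'n" by (simp add: riesz_kernel_def)
  have norm_int: "(\<integral>\<^sup>+y. ennreal (norm (riesz_kernel \<alpha> (x - y) *\<^sub>R f y)) \<partial>lebesgue) = abs_riesz \<alpha> f x" for x
    unfolding abs_riesz_def by (simp add: ennreal_mult k_nonneg)
  have conv: "riesz_convergent \<alpha> f x" if "abs_riesz \<alpha> f x < \<infinity>" for x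
    unfolding riesz_convergent_def using that
    by (intro integrableI_bounded) (auto simp only: norm_int intro!: borel_measurable_scaleR riesz_kernel_diff_borel_measurable fm)
  \<comment> \<open>The set where the potential of \<open>|f|\<close> is infinite lies in all superlevel sets, whose masses
    tend to \<open>0\<close>.\<close>
  show "AE x in lebesgue. u x \<noteq> 0 \<longrightarrow> riesz_convergent \<alpha> f x"
  proof -
    define Z where "Z = {x. abs_riesz \<alpha> f x = \<infinity>}"
    have "{x \<in> space lebesgue. abs_riesz \<alpha> f x = \<infinity>} \<in> sets lebesgue" by measurable
    then have [measurable]: "Z \<in> sets lebesgue" by (simp add: Z_def)
    have "(\<lambda>k. C * X / real (Suc k)) \<longlonglongrightarrow> 0"
      using LIMSEQ_Suc[OF lim_const_over_n[of "C * X"]] by simp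
    then have "(\<lambda>k. (C * X / real (Suc k)) powr (1 / p)) \<longlonglongrightarrow> 0 powr (1 / p)"
      using p C0 X by (intro tendsto_powr') auto
    then have lim: "(\<lambda>k. ennreal ((C * X / real (Suc k)) powr (1 / p))) \<longlonglongrightarrow> 0"
      using p by (auto dest: tendsto_ennrealI)
    have "weight_measure u Z \<le> 0"
    proof (rule LIMSEQ_le_const[OF lim], intro exI allI impI)
      fix k
      have "weight_measure u Z \<le> weight_measure u {x. ennreal (real (Suc k)) \<le> abs_riesz \<alpha> f x}"
        by (rule weight_measure_mono) (auto simp: Z_def)
      also have "\<dots> \<le> ennreal ((C * X / real (Suc k)) powr (1 / p))" by (rule weak) simp
      finally show "weight_measure u Z \<le> ennreal ((C * X / real (Suc k)) powr (1 / p))" .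
    qed
    then have "AE x in lebesgue. ennreal (u x) * indicator Z x = 0"
      unfolding weight_measure_def by (subst (asm) le_zero_eq, subst (asm) nn_integral_0_iff_AE) auto
    then show ?thesis
    proof eventually_elim
      case (elim x)
      have "u x \<ge> 0" using u by (simp add: weight_def)
      then show ?case using elim conv[of x] by (auto simp: Z_def indicator_def less_top split: if_splits)
    qed
  qed
  have sub: "{x. norm (frac_integral \<alpha> f x) > t} \<subseteq> {x. ennreal t \<le> abs_riesz \<alpha> f x}" if "0 < t" for t
  proof clarify
    \<comment> \<open>Where the defining integral diverges, the value of \<open>frac_integral\<close> is \<open>0\<close>, so such points
      do not occur in a superlevel set with \<open>t > 0\<close>.\<close>
    fix x assume *: "t < norm (frac_integral \<alpha> f x)"
    then have "integrable lebesgue (\<lambda>y. riesz_kernel \<alpha> (x - y) *\<^sub>R f y)"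
      using that by (auto simp: frac_integral_def not_integrable_integral_eq intro: ccontr)
    from integral_norm_bound_ennreal[OF this]
    have "ennreal (norm (frac_integral \<alpha> f x)) \<le> abs_riesz \<alpha> f x"
      unfolding norm_int by (simp add: frac_integral_def)
    moreover have "ennreal t \<le> ennreal (norm (frac_integral \<alpha> f x))" using * by (intro ennreal_leI) simp
    ultimately show "ennreal t \<le> abs_riesz \<alpha> f x" by (rule order_trans[rotated])
  qed
  have q: "1 / dual_exponent (real CARD('n) / \<alpha>) = p"
    using assms by (simp add: dual_exponent_def p_def field_simps)
  have "weak_norm (dual_exponent (real CARD('n) / \<alpha>)) u (frac_integral \<alpha> f) \<le> ennreal (C * X)"
    unfolding weak_norm_def q
  proof (rule SUP_least)
    fix t :: real assume "t \<in> {0<..}"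
    then have t: "0 < t" by simp
    have "weight_measure u {x. norm (frac_integral \<alpha> f x) > t} \<le> ennreal ((C * X / t) powr (1 / p))"
      using weight_measure_mono[OF sub[OF t]] weak[OF t] by (rule order_trans)
    then have "epow (weight_measure u {x. norm (frac_integral \<alpha> f x) > t}) p
        \<le> epow (ennreal ((C * X / t) powr (1 / p))) p"
      using p by (intro epow_mono) auto
    also have "\<dots> = ennreal (C * X / t)"
      using p C0 X t by (simp add: epow_def powr_powr)
    finally have "ennreal t * epow (weight_measure u {x. norm (frac_integral \<alpha> f x) > t}) p
        \<le> ennreal t * ennreal (C * X / t)" by (rule mult_left_mono) simp
    also have "\<dots> = ennreal (C * X)" using t C0 X by (simp flip: ennreal_mult)
    finally show "ennreal t * epow (weight_measure u {x. norm (frac_integral \<alpha> f x) > t}) p \<le> ennreal (C * X)" .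
  qed
  then show "weak_norm (dual_exponent (real CARD('n) / \<alpha>)) u (frac_integral \<alpha> f)
      \<le> ennreal (riesz_const \<alpha> CARD('n)) * L1_norm ?v f"
    using X C0 by (simp add: C_def ennreal_mult)
qed

end
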